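(* Suppose that $A_0$ and $A_1$ are jointly positive definite, that is, there exists $\mu_1\in\mathbb{R}$ such that $A_0+\mu_1A_1\succ 0$. Then the following statements are true. (i) If $A_1$ is semidefinite, i.e. $A_1\succeq 0$ or $A_1\preceq 0$, then the problem (GTR) has at most one local-nonglobal minimizer. (ii) If $A_1$ is indefinite, i.e. there exist $\bar x,\tilde x\in\mathbb{R}^n$ such that $\bar x^TA_1\bar x<0<\tilde x^TA_1\tilde x$, then the problem (GTR) has at most two local-nonglobal minimizers.
   Context: Let $A_0,A_1$ be real symmetric $n\times n$ matrices, $b_0,b_1\in\mathbb{R}^n$, $c_1\in\mathbb{R}$, $f_0(x)=x^TA_0x+2b_0^Tx$, $f_1(x)=x^TA_1x+2b_1^Tx+c_1$. Problem (GTR) is: minimize $f_0(x)$ over $x\in\mathbb{R}^n$ subject to $f_1(x)\le 0$. A local-nonglobal minimizer is a feasible point that is a local minimizer but not a global minimizer (a global minimizer being a feasible point whose objective value is at most that of every feasible point). *)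

theory Defs
  imports "HOL-Analysis.Analysis"
begin

text \<open>The symmetry of the matrix is a separate hypothesis, not part of the four
  definiteness notions.\<close>

definition pos_definite :: "real^'n^'n \<Rightarrow> bool" where
  "pos_definite A \<longleftrightarrow> (\<forall>x. x \<noteq> 0 \<longrightarrow> x \<bullet> (A *v x) > 0)"

definition pos_semidefinite :: "real^'n^'n \<Rightarrow> bool" where
  "pos_semidefinite A \<longleftrightarrow> (\<forall>x. x \<bullet> (A *v x) \<ge> 0)"

definition neg_semidefinite :: "real^'n^'n \<Rightarrow> bool" where
  "neg_semidefinite A \<longleftrightarrow> (\<forall>x. x \<bullet> (A *v x) \<le> 0)"

definition indefinite :: "real^'n^'n \<Rightarrow> bool" where
  "indefinite A \<longleftrightarrow> (\<exists>x y. x \<bullet> (A *v x) < 0 \<and> 0 < y \<bullet> (A *v y))"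

definition quad_fun :: "real^'n^'n \<Rightarrow> real^'n \<Rightarrow> real \<Rightarrow> real^'n \<Rightarrow> real" where
  "quad_fun A b c x = x \<bullet> (A *v x) + 2 * (b \<bullet> x) + c"

definition local_minimizer :: "('a::metric_space \<Rightarrow> real) \<Rightarrow> 'a set \<Rightarrow> 'a \<Rightarrow> bool" where
  "local_minimizer f S x \<longleftrightarrow>
     x \<in> S \<and> (\<exists>\<epsilon>>0. \<forall>y \<in> S \<inter> ball x \<epsilon>. f x \<le> f y)"

definition global_minimizer :: "('a \<Rightarrow> real) \<Rightarrow> 'a set \<Rightarrow> 'a \<Rightarrow> bool" where
  "global_minimizer f S x \<longleftrightarrow> x \<in> S \<and> (\<forall>y \<in> S. f x \<le> f y)"

definition local_nonglobal_minimizers :: "('a::metric_space \<Rightarrow> real) \<Rightarrow> 'a set \<Rightarrow> 'a set" where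
  "local_nonglobal_minimizers f S = {x. local_minimizer f S x \<and> \<not> global_minimizer f S x}"

definition gtr_feasible :: "real^'n^'n \<Rightarrow> real^'n \<Rightarrow> real \<Rightarrow> (real^'n) set" where
  "gtr_feasible A1 b1 c1 = {x. quad_fun A1 b1 c1 x \<le> 0}"

definition gtr_lngm ::
  "real^'n^'n \<Rightarrow> real^'n \<Rightarrow> real^'n^'n \<Rightarrow> real^'n \<Rightarrow> real \<Rightarrow> (real^'n) set" where
  "gtr_lngm A0 b0 A1 b1 c1 =
     local_nonglobal_minimizers (quad_fun A0 b0 0) (gtr_feasible A1 b1 c1)"

end

theory Submission
  imports Defs
begin

text \<open>
  Write \<open>f0\<close>, \<open>f1\<close> for the objective and the constraint function and
  \<open>A(\<mu>) = A0 + \<mu> A1\<close>. At a local-nonglobal minimizer \<open>x\<close> the constraint is active with a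
  nonzero gradient, since otherwise the objective could be followed along whole segments through
  \<open>x\<close>, where a quadratic function with a local minimum has a global one. So there is a
  multiplier \<open>\<mu> \<ge> 0\<close>, the form of \<open>A(\<mu>)\<close> is nonnegative on the tangent hyperplane, and it is
  negative somewhere, because a positive semidefinite \<open>A(\<mu>)\<close> would make \<open>x\<close> a global minimizer
  (lemma \<open>lngm_nonconvex_kkt\<close>).

  Fix \<open>\<mu>1\<close> with \<open>P = A(\<mu>1)\<close> positive definite and put \<open>t = \<mu> - \<mu>1\<close>, so \<open>A(\<mu>) = P + t A1\<close> and
  \<open>t \<noteq> 0\<close>. The theorem follows once each sign of \<open>t\<close> is shown to occur for at most one
  minimizer: \<open>A1 \<succeq> 0\<close> excludes \<open>t > 0\<close>, and \<open>A1 \<preceq> 0\<close> excludes \<open>t < 0\<close>.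

  For a fixed sign, all the matrices \<open>P + t A1\<close> that are not positive semidefinite are negative on
  one common direction \<open>v\<close>, an extreme eigenvector of \<open>A1\<close> relative to \<open>P\<close>
  (lemma \<open>least_generalized_eigenvector\<close>). If \<open>x\<close> and \<open>y\<close> are two minimizers with parameters
  \<open>t\<close> and \<open>s\<close>, then all the conditions found above survive in the plane through \<open>x\<close> spanned by
  \<open>v\<close> and \<open>y - x\<close>. In that plane \<open>P\<close> and \<open>A1\<close> are simultaneously diagonal, and the conditions
  at the two points become incompatible inequalities between real numbers
  (lemma \<open>planar_kkt_contradiction\<close>).
\<close>

section \<open>Quadratic functions along lines and parabolas\<close>

lemma inner_symmetric_matrix:
  fixes A :: "real^'n^'n"
  assumes "transpose A = A"
  shows "x \<bullet> (A *v y) = y \<bullet> (A *v x)"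
  by (metis assms dot_lmul_matrix inner_commute transpose_matrix_vector)

lemma quad_fun_add:
  fixes A :: "real^'n^'n"
  assumes "transpose A = A"
  shows "quad_fun A b c (x + d) = quad_fun A b c x + 2 * ((A *v x + b) \<bullet> d) + d \<bullet> (A *v d)"
  using inner_symmetric_matrix[OF assms, of x d]
  by (simp add: quad_fun_def matrix_vector_right_distrib inner_add_left inner_add_right
      inner_commute[of "A *v x" d])

lemma quad_fun_parabola:
  fixes A :: "real^'n^'n"
  assumes sym: "transpose A = A"
  shows "quad_fun A b c (x + (\<tau> *\<^sub>R v + \<tau>\<^sup>2 *\<^sub>R w)) = quad_fun A b c x
    + 2 * \<tau> * ((A *v x + b) \<bullet> v)
    + \<tau>\<^sup>2 * (v \<bullet> (A *v v) + 2 * ((A *v x + b) \<bullet> w)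
        + \<tau> * (2 * (v \<bullet> (A *v w)) + \<tau> * (w \<bullet> (A *v w))))"
  unfolding quad_fun_add[OF sym]
  using inner_symmetric_matrix[OF sym, of v w]
  by (simp add: matrix_vector_right_distrib inner_add_left inner_add_right
      matrix_vector_mult_scaleR algebra_simps power2_eq_square)

text \<open>The values at \<open>\<tau>\<close> and \<open>-\<tau>\<close> together bound \<open>\<bar>l\<bar>\<close> by \<open>\<bar>\<tau>\<bar> * q\<close> for every small \<open>\<tau>\<close>.\<close>

lemma quadratic_nonneg_near_zero:
  fixes l q :: real
  assumes "\<rho> > 0" and nn: "\<And>\<tau>. \<bar>\<tau>\<bar> < \<rho> \<Longrightarrow> 0 \<le> \<tau> * l + \<tau>\<^sup>2 * q"
  shows "l = 0" and "q \<ge> 0"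
proof -
  define s where "s = \<rho> / 2"
  have s: "s > 0" "\<bar>s\<bar> < \<rho>" using \<open>\<rho> > 0\<close> by (auto simp: s_def)
  have "0 \<le> s * l + s\<^sup>2 * q" "0 \<le> - s * l + s\<^sup>2 * q" using nn[of s] nn[of "- s"] s by auto
  hence "0 \<le> s\<^sup>2 * q" by linarith
  with s show "q \<ge> 0" by (simp add: zero_le_mult_iff)
  show "l = 0"
  proof (rule ccontr)
    assume l: "l \<noteq> 0"
    define k where "k = min s (\<bar>l\<bar> / (2 * (q + 1)))"
    have k: "k > 0" "\<bar>k\<bar> < \<rho>" "k \<le> \<bar>l\<bar> / (2 * (q + 1))"
      using s l \<open>q \<ge> 0\<close> by (auto simp: k_def)
    have "0 \<le> k * l + k\<^sup>2 * q" "0 \<le> - k * l + k\<^sup>2 * q" using nn[of k] nn[of "- k"] k by auto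
    hence "k * \<bar>l\<bar> \<le> k * (k * q)" by (auto simp: abs_if power2_eq_square algebra_simps)
    hence "\<bar>l\<bar> \<le> k * q" using k by simp
    moreover have "k * (q + 1) \<le> \<bar>l\<bar> / 2" using k \<open>q \<ge> 0\<close> by (simp add: field_simps)
    ultimately show False using k l by (simp add: algebra_simps)
  qed
qed

text \<open>On a line a quadratic function with a local minimum is convex, so the minimum is global there.
  Hence \<open>x + d\<close> itself may lie outside \<open>S\<close>: it is enough that \<open>S\<close> contains a short segment around
  \<open>x\<close> in the direction \<open>d\<close>.\<close>

lemma local_minimizer_global_along_line:
  fixes A :: "real^'n^'n"
  assumes sym: "transpose A = A" and loc: "local_minimizer (quad_fun A b c) S x"
    and "\<rho> > 0" and line: "\<And>\<tau>. \<bar>\<tau>\<bar> < \<rho> \<Longrightarrow> x + \<tau> *\<^sub>R d \<in> S"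
  shows "quad_fun A b c x \<le> quad_fun A b c (x + d)"
proof -
  obtain \<epsilon> where \<epsilon>: "\<epsilon> > 0" "\<And>y. y \<in> S \<Longrightarrow> dist x y < \<epsilon> \<Longrightarrow> quad_fun A b c x \<le> quad_fun A b c y"
    using loc by (auto simp: local_minimizer_def)
  define l where "l = 2 * ((A *v x + b) \<bullet> d)"
  define q where "q = d \<bullet> (A *v d)"
  define r where "r = min \<rho> (\<epsilon> / (norm d + 1))"
  have r: "r > 0" using \<open>\<rho> > 0\<close> \<epsilon>(1) by (simp add: r_def add_nonneg_pos)
  have "0 \<le> \<tau> * l + \<tau>\<^sup>2 * q" if "\<bar>\<tau>\<bar> < r" for \<tau>
  proof -
    have "\<bar>\<tau>\<bar> * (norm d + 1) < \<epsilon>"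
      using that by (simp add: r_def pos_less_divide_eq add_nonneg_pos)
    hence "dist x (x + \<tau> *\<^sub>R d) < \<epsilon>" by (simp add: dist_norm algebra_simps)
    hence "quad_fun A b c x \<le> quad_fun A b c (x + \<tau> *\<^sub>R d)"
      using that line[of \<tau>] by (intro \<epsilon>(2)) (auto simp: r_def)
    thus ?thesis
      by (simp add: quad_fun_add[OF sym] l_def q_def matrix_vector_mult_scaleR power2_eq_square
          algebra_simps)
  qed
  from quadratic_nonneg_near_zero[OF r this] have "l = 0" "q \<ge> 0" by auto
  thus ?thesis by (simp add: quad_fun_add[OF sym] l_def q_def)
qed

section \<open>Necessary conditions at a local-nonglobal minimizer\<close>

text \<open>The gradients of the two functions at \<open>x\<close> are \<open>2 (A0 x + b0)\<close> and \<open>2 (A1 x + b1)\<close>; the common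
  factor is dropped. The third conjunct is the second-order necessary condition for the Lagrangian
  on the tangent hyperplane, and the last one is the trace that nonglobality leaves.\<close>

definition nonconvex_kkt ::
  "real^'n^'n \<Rightarrow> real^'n \<Rightarrow> real^'n^'n \<Rightarrow> real^'n \<Rightarrow> real \<Rightarrow> real \<Rightarrow> real^'n \<Rightarrow> bool" where
  "nonconvex_kkt A0 b0 A1 b1 c1 \<mu> x \<longleftrightarrow>
     quad_fun A1 b1 c1 x = 0 \<and>
     (A0 *v x + b0) + \<mu> *\<^sub>R (A1 *v x + b1) = 0 \<and>
     (\<forall>v. v \<bullet> (A1 *v x + b1) = 0 \<longrightarrow> 0 \<le> v \<bullet> (A0 *v v) + \<mu> * (v \<bullet> (A1 *v v))) \<and>
     (\<exists>z. z \<bullet> (A0 *v z) + \<mu> * (z \<bullet> (A1 *v z)) < 0)"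

text \<open>A better feasible point \<open>y\<close> forces every segment around \<open>x\<close> in the direction \<open>y - x\<close> to leave
  the feasible set. In the interior short segments stay feasible. At a boundary point where the
  gradient vanishes the feasible set is \<open>x\<close> plus the cone of all \<open>e\<close> with \<open>e \<bullet> A1 e \<le> 0\<close>, and
  this cone contains the whole line through each of its points.\<close>

lemma lngm_on_regular_boundary:
  assumes sym: "transpose A0 = A0" "transpose A1 = A1"
    and x: "x \<in> gtr_lngm A0 b0 A1 b1 c1"
  shows "quad_fun A1 b1 c1 x = 0" and "A1 *v x + b1 \<noteq> 0"
proof -
  let ?S = "gtr_feasible A1 b1 c1"
  have loc: "local_minimizer (quad_fun A0 b0 0) ?S x"
    and ng: "\<not> global_minimizer (quad_fun A0 b0 0) ?S x"
    using x by (auto simp: gtr_lngm_def local_nonglobal_minimizers_def)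
  have xS: "x \<in> ?S" using loc by (simp add: local_minimizer_def)
  obtain y where y: "y \<in> ?S" "quad_fun A0 b0 0 y < quad_fun A0 b0 0 x"
    using ng xS by (auto simp: global_minimizer_def not_le)
  define d where "d = y - x"
  have leaves: "\<exists>\<tau>. \<bar>\<tau>\<bar> < \<rho> \<and> x + \<tau> *\<^sub>R d \<notin> ?S" if "\<rho> > 0" for \<rho>
    using local_minimizer_global_along_line[OF sym(1) loc that, of d] y by (force simp: d_def)
  show bd: "quad_fun A1 b1 c1 x = 0"
  proof (rule ccontr)
    assume "quad_fun A1 b1 c1 x \<noteq> 0"
    hence neg: "quad_fun A1 b1 c1 x < 0" using xS by (simp add: gtr_feasible_def)
    have "isCont (\<lambda>\<tau>. quad_fun A1 b1 c1 (x + \<tau> *\<^sub>R d)) 0"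
      unfolding quad_fun_add[OF sym(2)] matrix_vector_mult_scaleR by (intro continuous_intros)
    hence "((\<lambda>\<tau>. quad_fun A1 b1 c1 (x + \<tau> *\<^sub>R d)) \<longlongrightarrow> quad_fun A1 b1 c1 x) (at 0)"
      by (simp add: isCont_def)
    hence "\<forall>\<^sub>F \<tau> in at 0. quad_fun A1 b1 c1 (x + \<tau> *\<^sub>R d) < 0"
      using neg by (rule order_tendstoD)
    then obtain \<rho> where \<rho>: "\<rho> > 0"
      "\<And>\<tau>. \<tau> \<noteq> 0 \<Longrightarrow> \<bar>\<tau>\<bar> < \<rho> \<Longrightarrow> quad_fun A1 b1 c1 (x + \<tau> *\<^sub>R d) < 0"
      by (auto simp: eventually_at)
    obtain \<tau> where "\<bar>\<tau>\<bar> < \<rho>" "x + \<tau> *\<^sub>R d \<notin> ?S" using leaves[OF \<rho>(1)] by blast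
    thus False using \<rho>(2)[of \<tau>] neg by (cases "\<tau> = 0") (auto simp: gtr_feasible_def)
  qed
  show "A1 *v x + b1 \<noteq> 0"
  proof
    assume g: "A1 *v x + b1 = 0"
    have f1: "quad_fun A1 b1 c1 (x + e) = e \<bullet> (A1 *v e)" for e
      by (simp add: quad_fun_add[OF sym(2)] bd g)
    have "d \<bullet> (A1 *v d) \<le> 0" using y(1) f1[of d] by (simp add: gtr_feasible_def d_def)
    hence "x + \<tau> *\<^sub>R d \<in> ?S" for \<tau>
      unfolding gtr_feasible_def mem_Collect_eq f1
      by (simp add: matrix_vector_mult_scaleR mult_nonneg_nonpos flip: mult.assoc)
    thus False using leaves[of 1] by auto
  qed
qed

lemma eventually_local_minimizer_parabola:
  fixes x v w :: "real^'n"
  assumes loc: "local_minimizer f S x"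
    and feas: "\<forall>\<^sub>F \<tau> in at_right 0. x + (\<tau> *\<^sub>R v + \<tau>\<^sup>2 *\<^sub>R w) \<in> S"
  shows "\<forall>\<^sub>F \<tau> in at_right 0. f x \<le> f (x + (\<tau> *\<^sub>R v + \<tau>\<^sup>2 *\<^sub>R w))"
proof -
  obtain \<epsilon> where \<epsilon>: "\<epsilon> > 0" "\<And>y. y \<in> S \<Longrightarrow> dist x y < \<epsilon> \<Longrightarrow> f x \<le> f y"
    using loc by (auto simp: local_minimizer_def)
  have "((\<lambda>\<tau>. dist x (x + (\<tau> *\<^sub>R v + \<tau>\<^sup>2 *\<^sub>R w))) \<longlongrightarrow> dist x (x + (0 *\<^sub>R v + 0\<^sup>2 *\<^sub>R w)))
      (at_right 0)"
    by (intro tendsto_intros)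
  hence "\<forall>\<^sub>F \<tau> in at_right 0. dist x (x + (\<tau> *\<^sub>R v + \<tau>\<^sup>2 *\<^sub>R w)) < \<epsilon>"
    using \<epsilon>(1) by (intro order_tendstoD(2)) auto
  with feas show ?thesis by eventually_elim (rule \<epsilon>(2))
qed

text \<open>If both slopes were negative, a short step along \<open>v\<close> would be feasible and improve the
  objective.\<close>

lemma slope_nonneg_where_constraint_decreases:
  assumes sym: "transpose A0 = A0" "transpose A1 = A1"
    and loc: "local_minimizer (quad_fun A0 b0 0) (gtr_feasible A1 b1 c1) x"
    and bd: "quad_fun A1 b1 c1 x = 0"
    and v: "(A1 *v x + b1) \<bullet> v < 0"
  shows "0 \<le> (A0 *v x + b0) \<bullet> v"
proof (rule ccontr)
  assume "\<not> ?thesis"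
  hence neg: "(A0 *v x + b0) \<bullet> v < 0" by simp
  have ev: "\<forall>\<^sub>F \<tau> in at_right 0. quad_fun A b c (x + (\<tau> *\<^sub>R v + \<tau>\<^sup>2 *\<^sub>R 0)) < quad_fun A b c x"
    if sA: "transpose A = A" and n: "(A *v x + b) \<bullet> v < 0" for A b c
  proof -
    have "((\<lambda>\<tau>. 2 * ((A *v x + b) \<bullet> v) + \<tau> * (v \<bullet> (A *v v))) \<longlongrightarrow>
        2 * ((A *v x + b) \<bullet> v) + 0 * (v \<bullet> (A *v v))) (at_right 0)"
      by (intro tendsto_intros)
    hence "\<forall>\<^sub>F \<tau> in at_right 0. 2 * ((A *v x + b) \<bullet> v) + \<tau> * (v \<bullet> (A *v v)) < 0"
      by (rule order_tendstoD(2)) (use n in simp)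
    moreover have "\<forall>\<^sub>F \<tau>::real in at_right 0. \<tau> > 0" by (rule eventually_at_right_less)
    ultimately show ?thesis
    proof eventually_elim
      case (elim \<tau>)
      hence "\<tau> * (2 * ((A *v x + b) \<bullet> v) + \<tau> * (v \<bullet> (A *v v))) < 0" by (simp add: mult_pos_neg)
      thus ?case unfolding quad_fun_parabola[OF sA] by (simp add: algebra_simps power2_eq_square)
    qed
  qed
  have "\<forall>\<^sub>F \<tau> in at_right 0. x + (\<tau> *\<^sub>R v + \<tau>\<^sup>2 *\<^sub>R 0) \<in> gtr_feasible A1 b1 c1"
    using ev[OF sym(2) v, of c1] by eventually_elim (simp add: gtr_feasible_def bd)
  from eventually_local_minimizer_parabola[OF loc this] ev[OF sym(1) neg, of 0]
  have "\<forall>\<^sub>F \<tau> in at_right (0::real). False" by eventually_elim simp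
  thus False by simp
qed

text \<open>The parabola \<open>x + \<tau> v + \<tau>\<^sup>2 w\<close> replaces a curve inside the boundary. Along it the terms of
  order \<open>\<tau>\<close> of both functions vanish, and those of order \<open>\<tau>\<^sup>2\<close> decide: the constraint's keeps the parabola
  feasible, so the objective's cannot be negative. No curve on the surface itself,
  hence no implicit function theorem, has to be constructed.\<close>

lemma curvature_nonneg_where_constraint_bends_down:
  assumes sym: "transpose A0 = A0" "transpose A1 = A1"
    and loc: "local_minimizer (quad_fun A0 b0 0) (gtr_feasible A1 b1 c1) x"
    and bd: "quad_fun A1 b1 c1 x = 0"
    and tan: "(A1 *v x + b1) \<bullet> v = 0" "(A0 *v x + b0) \<bullet> v = 0"
    and w: "v \<bullet> (A1 *v v) + 2 * ((A1 *v x + b1) \<bullet> w) < 0"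
  shows "0 \<le> v \<bullet> (A0 *v v) + 2 * ((A0 *v x + b0) \<bullet> w)"
proof (rule ccontr)
  assume "\<not> ?thesis"
  hence neg: "v \<bullet> (A0 *v v) + 2 * ((A0 *v x + b0) \<bullet> w) < 0" by simp
  have ev: "\<forall>\<^sub>F \<tau> in at_right 0. quad_fun A b c (x + (\<tau> *\<^sub>R v + \<tau>\<^sup>2 *\<^sub>R w)) < quad_fun A b c x"
    if sA: "transpose A = A" and t: "(A *v x + b) \<bullet> v = 0"
      and n: "v \<bullet> (A *v v) + 2 * ((A *v x + b) \<bullet> w) < 0" for A b c
  proof -
    let ?r = "\<lambda>\<tau>. v \<bullet> (A *v v) + 2 * ((A *v x + b) \<bullet> w)
        + \<tau> * (2 * (v \<bullet> (A *v w)) + \<tau> * (w \<bullet> (A *v w)))"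
    have "(?r \<longlongrightarrow> ?r 0) (at_right 0)" by (intro tendsto_intros)
    hence "\<forall>\<^sub>F \<tau> in at_right 0. ?r \<tau> < 0" using n by (intro order_tendstoD(2)) auto
    moreover have "\<forall>\<^sub>F \<tau>::real in at_right 0. \<tau> > 0" by (rule eventually_at_right_less)
    ultimately show ?thesis
    proof eventually_elim
      case (elim \<tau>)
      hence "\<tau>\<^sup>2 * ?r \<tau> < 0" by (intro mult_pos_neg) auto
      thus ?case unfolding quad_fun_parabola[OF sA] t by simp
    qed
  qed
  have "\<forall>\<^sub>F \<tau> in at_right 0. x + (\<tau> *\<^sub>R v + \<tau>\<^sup>2 *\<^sub>R w) \<in> gtr_feasible A1 b1 c1"
    using ev[OF sym(2) tan(1) w, of c1] by eventually_elim (simp add: gtr_feasible_def bd)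
  from eventually_local_minimizer_parabola[OF loc this] ev[OF sym(1) tan(2) neg, of 0]
  have "\<forall>\<^sub>F \<tau> in at_right (0::real). False" by eventually_elim simp
  thus False by simp
qed

text \<open>The Farkas lemma for a single strict inequality. The component \<open>p\<close> of \<open>h\<close> orthogonal to \<open>g\<close> must
  vanish, because \<open>-p\<close>, tilted slightly into the half space by \<open>- \<eta> g\<close>, is an admissible test
  direction for every \<open>\<eta> > 0\<close>.\<close>

lemma multiplier_of_half_space:
  fixes g h :: "'a::real_inner"
  assumes g: "g \<noteq> 0" and half: "\<And>v. g \<bullet> v < 0 \<Longrightarrow> 0 \<le> h \<bullet> v"
  shows "\<exists>\<mu>\<ge>0. h + \<mu> *\<^sub>R g = 0"
proof -
  define \<mu> where "\<mu> = - (h \<bullet> g) / (g \<bullet> g)"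
  define p where "p = h + \<mu> *\<^sub>R g"
  have gg: "g \<bullet> g > 0" using g by simp
  have gp: "g \<bullet> p = 0" using gg by (simp add: p_def \<mu>_def inner_add_right inner_diff_right inner_commute)
  have hg: "h \<bullet> g \<le> 0" using half[of "- g"] gg by simp
  have hp: "h \<bullet> p = p \<bullet> p"
    using gp inner_add_left[of h "\<mu> *\<^sub>R g" p] by (simp flip: p_def)
  have "p \<bullet> p \<le> 0"
  proof (rule field_le_epsilon)
    fix e :: real assume e: "e > 0"
    define \<eta> where "\<eta> = e / (1 - h \<bullet> g)"
    have \<eta>: "\<eta> > 0" "\<eta> * (1 - h \<bullet> g) = e" using e hg by (auto simp: \<eta>_def)
    have "g \<bullet> (- p - \<eta> *\<^sub>R g) < 0" using gp gg \<eta> by (simp add: inner_diff_right)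
    from half[OF this] have "p \<bullet> p \<le> - (\<eta> * (h \<bullet> g))" by (simp add: inner_diff_right hp)
    also have "\<dots> \<le> e" using \<eta> by (simp add: algebra_simps)
    finally show "p \<bullet> p \<le> 0 + e" by simp
  qed
  hence "p = 0" using inner_ge_zero[of p] inner_eq_zero_iff[of p] by linarith
  moreover have "\<mu> \<ge> 0" using hg gg by (simp add: \<mu>_def divide_nonpos_pos)
  ultimately show ?thesis by (auto simp: p_def)
qed

text \<open>The second-order condition comes from parabolas bent along the constraint gradient \<open>g\<close> just
  enough to be feasible; stationarity converts the bending term of the objective into \<open>\<mu>\<close> times
  the curvature of the constraint. For the negative direction, compare \<open>x\<close> with a better feasible
  point \<open>y\<close>: the quadratic part of the Lagrangian at \<open>y - x\<close> equals
  \<open>f0 y - f0 x + \<mu> * f1 y\<close>, which is negative.\<close>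

lemma lngm_nonconvex_kkt:
  assumes sym: "transpose A0 = A0" "transpose A1 = A1"
    and x: "x \<in> gtr_lngm A0 b0 A1 b1 c1"
  shows "\<exists>\<mu>. nonconvex_kkt A0 b0 A1 b1 c1 \<mu> x"
proof -
  let ?S = "gtr_feasible A1 b1 c1"
  define g where "g = A1 *v x + b1"
  define h where "h = A0 *v x + b0"
  have loc: "local_minimizer (quad_fun A0 b0 0) ?S x"
    and ng: "\<not> global_minimizer (quad_fun A0 b0 0) ?S x"
    using x by (auto simp: gtr_lngm_def local_nonglobal_minimizers_def)
  have xS: "x \<in> ?S" using loc by (simp add: local_minimizer_def)
  have bd: "quad_fun A1 b1 c1 x = 0" and g0: "g \<noteq> 0"
    using lngm_on_regular_boundary[OF sym x] by (auto simp: g_def)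
  hence gg: "g \<bullet> g > 0" by simp
  obtain \<mu> where \<mu>: "\<mu> \<ge> 0" "h + \<mu> *\<^sub>R g = 0"
    using multiplier_of_half_space[OF g0, of h] slope_nonneg_where_constraint_decreases[OF sym loc bd]
    by (auto simp: g_def h_def)
  have h: "h \<bullet> u = - \<mu> * (g \<bullet> u)" for u
    using arg_cong[OF \<mu>(2), of "\<lambda>z. z \<bullet> u"] by (simp add: inner_add_left)
  have second: "0 \<le> v \<bullet> (A0 *v v) + \<mu> * (v \<bullet> (A1 *v v))" if "v \<bullet> g = 0" for v
  proof -
    have tan: "g \<bullet> v = 0" "h \<bullet> v = 0" using that by (auto simp: h inner_commute)
    have *: "- (v \<bullet> (A0 *v v)) \<le> \<mu> * (v \<bullet> (A1 *v v))"
    proof (rule field_le_epsilon)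
      fix e :: real assume e: "e > 0"
      define \<eta> where "\<eta> = e / (\<mu> + 1)"
      have \<eta>: "\<eta> > 0" "\<mu> * \<eta> \<le> e" using e \<mu>(1) by (auto simp: \<eta>_def field_simps)
      \<comment> \<open>This bend makes the constraint's coefficient of order two equal to \<open>-\<eta>\<close>.\<close>
      define w where "w = (- (v \<bullet> (A1 *v v) + \<eta>) / (2 * (g \<bullet> g))) *\<^sub>R g"
      have gw: "2 * (g \<bullet> w) = - (v \<bullet> (A1 *v v) + \<eta>)" using g0 by (simp add: w_def)
      have "0 \<le> v \<bullet> (A0 *v v) + 2 * (h \<bullet> w)"
        using curvature_nonneg_where_constraint_bends_down[OF sym loc bd, of v w] tan gw \<eta>(1)
        by (simp add: g_def h_def)
      also have "2 * (h \<bullet> w) = - \<mu> * (2 * (g \<bullet> w))" by (simp add: h)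
      also have "\<dots> = \<mu> * (v \<bullet> (A1 *v v)) + \<mu> * \<eta>" unfolding gw by (simp add: algebra_simps)
      finally show "- (v \<bullet> (A0 *v v)) \<le> \<mu> * (v \<bullet> (A1 *v v)) + e" using \<eta>(2) by linarith
    qed
    thus ?thesis by linarith
  qed
  obtain y where y: "y \<in> ?S" "quad_fun A0 b0 0 y < quad_fun A0 b0 0 x"
    using ng xS by (auto simp: global_minimizer_def not_le)
  define d where "d = y - x"
  have f0: "quad_fun A0 b0 0 y = quad_fun A0 b0 0 x - 2 * \<mu> * (g \<bullet> d) + d \<bullet> (A0 *v d)"
    using quad_fun_add[OF sym(1), of b0 0 x d] h[of d] by (simp add: h_def d_def)
  have f1: "quad_fun A1 b1 c1 y = 2 * (g \<bullet> d) + d \<bullet> (A1 *v d)"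
    using quad_fun_add[OF sym(2), of b1 c1 x d] bd by (simp add: g_def d_def)
  have "\<mu> * (2 * (g \<bullet> d) + d \<bullet> (A1 *v d)) \<le> 0"
    using y(1) \<mu>(1) f1 by (simp add: gtr_feasible_def mult_nonneg_nonpos)
  hence "d \<bullet> (A0 *v d) + \<mu> * (d \<bullet> (A1 *v d)) < 0"
    using y(2) f0 by (simp add: algebra_simps)
  thus ?thesis using bd \<mu> second unfolding nonconvex_kkt_def g_def h_def by blast
qed

section \<open>An extreme generalized eigenvector\<close>

text \<open>\<open>v\<close> minimizes the form, so the derivative of the form at \<open>v\<close> in the direction \<open>M v\<close> is
  zero.\<close>

lemma psd_form_zero_imp_kernel:
  fixes M :: "real^'n^'n"
  assumes sym: "transpose M = M" and psd: "pos_semidefinite M" and v: "v \<bullet> (M *v v) = 0"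
  shows "M *v v = 0"
proof -
  define u where "u = M *v v"
  have "0 \<le> \<tau> * (2 * (u \<bullet> u)) + \<tau>\<^sup>2 * (u \<bullet> (M *v u))" for \<tau>
  proof -
    have "0 \<le> (v + \<tau> *\<^sub>R u) \<bullet> (M *v (v + \<tau> *\<^sub>R u))"
      using psd by (simp add: pos_semidefinite_def)
    thus ?thesis
      using v inner_symmetric_matrix[OF sym, of v u]
      by (simp add: matrix_vector_right_distrib inner_add_left inner_add_right
          matrix_vector_mult_scaleR algebra_simps power2_eq_square flip: u_def)
  qed
  hence "2 * (u \<bullet> u) = 0" by (intro quadratic_nonneg_near_zero(1)[of 1]) auto
  thus ?thesis by (simp add: u_def)
qed

text \<open>Minimize the Rayleigh quotient of \<open>Q\<close> relative to \<open>P\<close> over the unit sphere. With \<open>a\<close> the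
  minimum, \<open>Q - a P\<close> is positive semidefinite and its form vanishes at the minimizer, which
  therefore lies in the kernel.\<close>

lemma least_generalized_eigenvector:
  fixes P Q :: "real^'n^'n"
  assumes symP: "transpose P = P" and symQ: "transpose Q = Q" and pd: "pos_definite P"
  shows "\<exists>v a. v \<bullet> (P *v v) = 1 \<and> Q *v v = a *\<^sub>R (P *v v) \<and>
    (\<forall>z. a * (z \<bullet> (P *v z)) \<le> z \<bullet> (Q *v z))"
proof -
  let ?R = "\<lambda>z. (z \<bullet> (Q *v z)) / (z \<bullet> (P *v z))"
  have pos: "z \<bullet> (P *v z) > 0" if "z \<noteq> 0" for z
    using pd that by (simp add: pos_definite_def)
  have "continuous_on (sphere 0 1) ?R"
  proof (intro continuous_on_divide continuous_on_inner continuous_on_id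
      linear_continuous_on linear_linear[THEN iffD1] matrix_vector_mul_linear
      matrix_vector_mul_bounded_linear ballI)
    fix z :: "real^'n" assume "z \<in> sphere 0 1"
    hence "z \<noteq> 0" by auto
    from pos[OF this] show "z \<bullet> (P *v z) \<noteq> 0" by simp
  qed
  moreover have "sphere (0 :: real^'n) 1 \<noteq> {}" by simp
  ultimately obtain e where e: "norm e = 1" and min: "\<And>z. norm z = 1 \<Longrightarrow> ?R e \<le> ?R z"
    using continuous_attains_inf[of "sphere (0 :: real^'n) 1" ?R] by (auto simp: compact_sphere)
  define a where "a = ?R e"
  have lower: "a * (z \<bullet> (P *v z)) \<le> z \<bullet> (Q *v z)" for z
  proof (cases "z = 0")
    case False
    have "?R ((1 / norm z) *\<^sub>R z) = ?R z"
      using False by (simp add: matrix_vector_mult_scaleR)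
    moreover have "norm ((1 / norm z) *\<^sub>R z) = 1" using False by simp
    ultimately have "a \<le> ?R z" using min unfolding a_def by metis
    thus ?thesis using pos[OF False] by (simp add: pos_le_divide_eq)
  qed simp
  have e0: "e \<noteq> 0" using e by auto
  define M where "M = Q - a *\<^sub>R P"
  have Mv: "M *v z = Q *v z - a *\<^sub>R (P *v z)" for z
    by (simp add: M_def matrix_vector_mult_diff_rdistrib scaleR_matrix_vector_assoc)
  have "transpose M = M"
    using symP symQ by (simp add: M_def transpose_def vec_eq_iff)
  moreover have "pos_semidefinite M"
    using lower by (simp add: pos_semidefinite_def Mv inner_diff_right)
  moreover have "e \<bullet> (M *v e) = 0"
    using pos[OF e0] by (simp add: Mv inner_diff_right a_def)
  ultimately have "M *v e = 0" by (rule psd_form_zero_imp_kernel)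
  hence eig: "Q *v e = a *\<^sub>R (P *v e)" by (simp add: Mv)
  define k where "k = sqrt (e \<bullet> (P *v e))"
  have k: "k > 0" "k * k = e \<bullet> (P *v e)" using pos[OF e0] by (auto simp: k_def)
  define v where "v = (1 / k) *\<^sub>R e"
  have "v \<bullet> (P *v v) = 1" using k by (simp add: v_def matrix_vector_mult_scaleR flip: k(2))
  moreover have "Q *v v = a *\<^sub>R (P *v v)" by (simp add: v_def matrix_vector_mult_scaleR eig)
  ultimately show ?thesis using lower by blast
qed

section \<open>Uniqueness on one side of the interval of positive definiteness\<close>

text \<open>
  The two-point comparison in coordinates. The plane has the \<open>P\<close>-orthogonal basis \<open>v\<close>, \<open>w\<close> with
  \<open>v \<bullet> P v = 1\<close>, \<open>w \<bullet> P w = W\<close>, \<open>v \<bullet> A1 v = a\<close>, \<open>w \<bullet> A1 w = C\<close>, and \<open>y - x = \<delta> v + w\<close>; the numbers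
  \<open>px\<close>, \<open>rx\<close> and \<open>py\<close>, \<open>ry\<close> are the components of the (halved) constraint gradients at \<open>x\<close> and \<open>y\<close>
  along \<open>v\<close> and \<open>w\<close>. The assumptions after \<open>W > 0\<close> are, in order: negativity on \<open>v\<close>, the change of the constraint
  gradient, the difference of the two stationarity equations, the equality of the constraint values
  at \<open>x\<close> and \<open>y\<close>, and the second-order conditions on the tangent vectors.

  With \<open>-\<alpha>\<close>, \<open>-\<alpha>'\<close> and \<open>\<gamma>\<close>, \<open>\<gamma>'\<close> the eigenvalues of \<open>P + t A1\<close>, \<open>P + s A1\<close> relative to \<open>P\<close> on \<open>v\<close> and
  \<open>w\<close>, the second-order conditions force \<open>\<gamma>, \<gamma>' > 0\<close>. Eliminating the gradients from the equality of
  the constraint values turns the condition at \<open>x\<close> into \<open>\<gamma>' \<alpha> \<le> \<gamma> \<alpha>'\<close> and the one at \<open>y\<close> into the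
  reverse inequality. Equality means \<open>(t - s) (a - C / W) = 0\<close>, so \<open>v\<close> and \<open>w\<close> would have the same
  eigenvalue, although \<open>-\<alpha> < 0 < \<gamma>\<close>.
\<close>

lemma planar_kkt_contradiction:
  fixes \<delta> W C a t s px py rx ry :: real
  assumes W: "W > 0"
    and neg: "1 + t * a < 0" "1 + s * a < 0"
    and dp: "py - px = a * \<delta>" and dr: "ry - rx = C"
    and kp: "\<delta> = t * px - s * py" and kr: "W = t * rx - s * ry"
    and bd: "\<delta> * (px + py) + (rx + ry) = 0"
    and sx: "0 \<le> rx\<^sup>2 * (1 + t * a) + px\<^sup>2 * (W + t * C)"
    and sy: "0 \<le> ry\<^sup>2 * (1 + s * a) + py\<^sup>2 * (W + s * C)"
  shows False
proof -
  define c where "c = C / W"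
  have C: "C = c * W" using W by (simp add: c_def)
  define \<alpha> where "\<alpha> = - (1 + t * a)"
  define \<alpha>' where "\<alpha>' = - (1 + s * a)"
  define \<gamma> where "\<gamma> = 1 + t * c"
  define \<gamma>' where "\<gamma>' = 1 + s * c"
  have \<alpha>: "\<alpha> > 0" "\<alpha>' > 0" using neg by (auto simp: \<alpha>_def \<alpha>'_def)
  have pa: "py * \<alpha>' = px * \<alpha>" using dp unfolding kp \<alpha>_def \<alpha>'_def by algebra
  have "ry - rx = c * (t * rx - s * ry)" using dr C kr by simp
  hence rg: "ry * \<gamma>' = rx * \<gamma>" unfolding \<gamma>_def \<gamma>'_def by algebra
  have sx': "rx\<^sup>2 * \<alpha> \<le> px\<^sup>2 * W * \<gamma>" using sx by (simp add: C \<alpha>_def \<gamma>_def algebra_simps)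
  have sy': "ry\<^sup>2 * \<alpha>' \<le> py\<^sup>2 * W * \<gamma>'" using sy by (simp add: C \<alpha>'_def \<gamma>'_def algebra_simps)
  have r0: "\<not> (rx = 0 \<and> ry = 0)" using kr W by auto
  have p0: "px \<noteq> 0" "py \<noteq> 0"
  proof -
    have "rx = 0" "ry = 0" if "px = 0" "py = 0"
      using sx' sy' that \<alpha> by (auto simp: mult_le_0_iff)
    moreover have "px = 0 \<longleftrightarrow> py = 0" using pa \<alpha> by auto
    ultimately show "px \<noteq> 0" "py \<noteq> 0" using r0 by auto
  qed
  have nn: "\<gamma> \<ge> 0" "\<gamma>' \<ge> 0"
  proof -
    have "0 \<le> px\<^sup>2 * W * \<gamma>"
      using sx' \<alpha> by (intro order.trans[OF _ sx']) simp
    moreover have "px\<^sup>2 * W > 0" using p0 W by simp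
    ultimately show "\<gamma> \<ge> 0" using zero_le_mult_iff[of "px\<^sup>2 * W" \<gamma>] by linarith
    have "0 \<le> py\<^sup>2 * W * \<gamma>'"
      using sy' \<alpha> by (intro order.trans[OF _ sy']) simp
    moreover have "py\<^sup>2 * W > 0" using p0 W by simp
    ultimately show "\<gamma>' \<ge> 0" using zero_le_mult_iff[of "py\<^sup>2 * W" \<gamma>'] by linarith
  qed
  have "\<gamma> = 0 \<Longrightarrow> rx = 0" using sx' \<alpha> by (auto simp: mult_le_0_iff)
  moreover have "\<gamma>' = 0 \<Longrightarrow> ry = 0" using sy' \<alpha> by (auto simp: mult_le_0_iff)
  ultimately have \<gamma>: "\<gamma> > 0" "\<gamma>' > 0" using nn rg r0 by (auto simp: less_le)
  \<comment> \<open>By \<open>pa\<close> and \<open>rg\<close> the components along \<open>v\<close>, and those along \<open>w\<close>, are known up to one factor each.\<close>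
  define \<beta> where "\<beta> = px / \<alpha>'"
  define \<epsilon> where "\<epsilon> = rx / \<gamma>'"
  have px: "px = \<beta> * \<alpha>'" and rx: "rx = \<epsilon> * \<gamma>'" using \<alpha> \<gamma> by (auto simp: \<beta>_def \<epsilon>_def)
  have py: "py = \<beta> * \<alpha>" and ry: "ry = \<epsilon> * \<gamma>"
    using pa rg \<alpha> \<gamma> by (auto simp: \<beta>_def \<epsilon>_def field_simps)
  have \<delta>: "\<delta> = - \<beta> * (t - s)" unfolding kp px py \<alpha>_def \<alpha>'_def by algebra
  have We: "W = \<epsilon> * (t - s)" unfolding kr rx ry \<gamma>_def \<gamma>'_def by algebra
  have ts: "t \<noteq> s" and \<epsilon>0: "\<epsilon> \<noteq> 0" using We W by auto
  define B where "B = \<beta>\<^sup>2 * W"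
  define E where "E = \<epsilon>\<^sup>2"
  have E: "E > 0" using \<epsilon>0 by (simp add: E_def)
  have "\<epsilon> * (\<delta> * (px + py) + (rx + ry)) = 0" using bd by simp
  hence bal: "B * (\<alpha> + \<alpha>') = E * (\<gamma> + \<gamma>')"
    unfolding B_def E_def We \<delta> px py rx ry by algebra
  have s1: "E * (\<gamma>'\<^sup>2 * \<alpha>) \<le> B * (\<alpha>'\<^sup>2 * \<gamma>)"
    using sx' unfolding px rx B_def E_def by (simp add: power_mult_distrib mult_ac)
  have s2: "E * (\<gamma>\<^sup>2 * \<alpha>') \<le> B * (\<alpha>\<^sup>2 * \<gamma>')"
    using sy' unfolding py ry B_def E_def by (simp add: power_mult_distrib mult_ac)
  \<comment> \<open>Multiplied by \<open>u + u'\<close>, the second-order condition loses \<open>B\<close> and \<open>E\<close> and the difference of its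
    two sides factors. The condition at \<open>y\<close> is the one at \<open>x\<close> with primes exchanged.\<close>
  have key: "g' * u \<le> g * u'"
    if pos: "u > 0" "u' > 0" "g > 0" "g' > 0" and b: "B * (u + u') = E * (g + g')"
      and s: "E * (g'\<^sup>2 * u) \<le> B * (u'\<^sup>2 * g)" for u u' g g' :: real
  proof -
    have "E * (g'\<^sup>2 * u) * (u + u') \<le> B * (u'\<^sup>2 * g) * (u + u')"
      using s pos by (intro mult_right_mono) auto
    also have "\<dots> = (B * (u + u')) * (u'\<^sup>2 * g)" by (simp add: mult_ac)
    also have "\<dots> = E * (g + g') * (u'\<^sup>2 * g)" by (simp only: b)
    finally have "E * (g'\<^sup>2 * u * (u + u')) \<le> E * ((g + g') * (u'\<^sup>2 * g))"
      by (simp only: mult.assoc)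
    hence "g'\<^sup>2 * u * (u + u') \<le> (g + g') * (u'\<^sup>2 * g)" using E by simp
    hence "0 \<le> (g * u' - g' * u) * (g * u' + g' * u + g' * u')"
      by (simp add: algebra_simps power2_eq_square)
    moreover have "g * u' + g' * u + g' * u' > 0" using pos by (simp add: add_pos_pos)
    ultimately show ?thesis by (simp add: zero_le_mult_iff)
  qed
  have "\<gamma>' * \<alpha> \<le> \<gamma> * \<alpha>'" using key[OF \<alpha> \<gamma> bal s1] .
  moreover have "\<gamma> * \<alpha>' \<le> \<gamma>' * \<alpha>"
    using key[OF \<alpha>(2,1) \<gamma>(2,1) _ s2] bal by (simp add: add.commute)
  ultimately have "\<gamma>' * \<alpha> = \<gamma> * \<alpha>'" by simp
  hence "(t - s) * (a - c) = 0" unfolding \<alpha>_def \<alpha>'_def \<gamma>_def \<gamma>'_def by algebra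
  hence "\<gamma> = - \<alpha>" using ts by (simp add: \<gamma>_def \<alpha>_def)
  thus False using \<alpha> \<gamma> by simp
qed

text \<open>Split \<open>y - x\<close> into its component along \<open>v\<close> and the \<open>P\<close>-orthogonal remainder \<open>w\<close>. Because \<open>v\<close> is
  an eigenvector, \<open>w\<close> is also orthogonal to it with respect to \<open>A1\<close>, which decouples all conditions.
  If \<open>w \<noteq> 0\<close> the planar comparison applies. If \<open>w = 0\<close>, both points lie on one line in the
  direction \<open>v\<close>; equal constraint values make the slopes of the constraint at the two points
  opposite, which contradicts stationarity as both forms are negative on \<open>v\<close>.\<close>

lemma nonconvex_kkt_unique:
  fixes A0 A1 :: "real^'n^'n"
  assumes sym: "transpose A0 = A0" "transpose A1 = A1"
    and pd: "pos_definite (A0 + \<mu>1 *\<^sub>R A1)"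
    and v1: "v \<bullet> ((A0 + \<mu>1 *\<^sub>R A1) *v v) = 1"
    and eig: "A1 *v v = a *\<^sub>R ((A0 + \<mu>1 *\<^sub>R A1) *v v)"
    and x: "nonconvex_kkt A0 b0 A1 b1 c1 (\<mu>1 + t) x" and tneg: "1 + t * a < 0"
    and y: "nonconvex_kkt A0 b0 A1 b1 c1 (\<mu>1 + s) y" and sneg: "1 + s * a < 0"
  shows "x = y"
proof -
  define P where "P = A0 + \<mu>1 *\<^sub>R A1"
  have symP: "transpose P = P" using sym by (simp add: P_def transpose_def vec_eq_iff)
  have Pv: "P *v z = A0 *v z + \<mu>1 *\<^sub>R (A1 *v z)" for z
    by (simp add: P_def matrix_vector_mult_add_rdistrib scaleR_matrix_vector_assoc)
  define d where "d = y - x"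
  define \<delta> where "\<delta> = d \<bullet> (P *v v)"
  define w where "w = d - \<delta> *\<^sub>R v"
  have d: "d = \<delta> *\<^sub>R v + w" by (simp add: w_def)
  have vv: "v \<bullet> (P *v v) = 1" using v1 by (simp add: P_def)
  have eig': "A1 *v v = a *\<^sub>R (P *v v)" using eig by (simp add: P_def)
  have wv: "w \<bullet> (P *v v) = 0" by (simp add: w_def inner_diff_left vv \<delta>_def)
  have vw: "v \<bullet> (P *v w) = 0" using inner_symmetric_matrix[OF symP, of v w] wv by simp
  have wv1: "w \<bullet> (A1 *v v) = 0" by (simp add: eig' wv)
  have vw1: "v \<bullet> (A1 *v w) = 0" using inner_symmetric_matrix[OF sym(2), of v w] wv1 by simp
  have vv1: "v \<bullet> (A1 *v v) = a" by (simp add: eig' vv)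
  define W where "W = w \<bullet> (P *v w)"
  define C where "C = w \<bullet> (A1 *v w)"
  define gx where "gx = A1 *v x + b1"
  define gy where "gy = A1 *v y + b1"
  have yx: "y = x + d" by (simp add: d_def)
  have gd: "gy - gx = A1 *v d" by (simp add: gx_def gy_def yx matrix_vector_right_distrib)
  have kkt: "(A0 *v x + b0) + (\<mu>1 + t) *\<^sub>R gx = 0" "(A0 *v y + b0) + (\<mu>1 + s) *\<^sub>R gy = 0"
    using x y by (auto simp: nonconvex_kkt_def gx_def gy_def)
  have "A0 *v x = - (b0 + (\<mu>1 + t) *\<^sub>R gx)" "A0 *v y = - (b0 + (\<mu>1 + s) *\<^sub>R gy)"
    using kkt unfolding eq_neg_iff_add_eq_0 add.assoc by auto
  moreover have "P *v d = (A0 *v y - A0 *v x) + \<mu>1 *\<^sub>R (gy - gx)"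
    unfolding Pv gd by (simp add: d_def matrix_vector_mult_diff_distrib)
  ultimately have Pd: "P *v d = t *\<^sub>R gx - s *\<^sub>R gy"
    by (simp add: scaleR_left_distrib scaleR_right_diff_distrib)
  define px where "px = gx \<bullet> v"
  define py where "py = gy \<bullet> v"
  define rx where "rx = gx \<bullet> w"
  define ry where "ry = gy \<bullet> w"
  have Ad: "v \<bullet> (A1 *v d) = a * \<delta>" "w \<bullet> (A1 *v d) = C"
    by (simp_all add: d matrix_vector_right_distrib inner_add_right matrix_vector_mult_scaleR
        vv1 vw1 wv1 C_def)
  have dp: "py - px = a * \<delta>" and dr: "ry - rx = C"
    using Ad unfolding gd[symmetric] px_def py_def rx_def ry_def
    by (simp_all add: inner_diff_right inner_commute)
  have Pd': "v \<bullet> (P *v d) = \<delta>" "w \<bullet> (P *v d) = W"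
    by (simp_all add: d matrix_vector_right_distrib inner_add_right matrix_vector_mult_scaleR
        vv vw wv W_def)
  have kp: "\<delta> = t * px - s * py" and kr: "W = t * rx - s * ry"
    using Pd' unfolding Pd px_def py_def rx_def ry_def
    by (simp_all add: inner_diff_right inner_commute)
  have "2 * (gx \<bullet> d) + d \<bullet> (A1 *v d) = 0"
    using quad_fun_add[OF sym(2), of b1 c1 x d] x y
    by (simp add: nonconvex_kkt_def gx_def yx)
  hence "(gx + gy) \<bullet> d = 0"
    unfolding gd[symmetric] by (simp add: inner_diff_right inner_add_left inner_add_right inner_commute)
  hence bd: "\<delta> * (px + py) + (rx + ry) = 0"
    by (simp add: d px_def py_def rx_def ry_def inner_add_left inner_add_right algebra_simps)
  \<comment> \<open>The tangent direction inside the plane is the combination of \<open>v\<close> and \<open>w\<close> orthogonal to the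
    gradient \<open>g\<close>.\<close>
  have so: "0 \<le> (g \<bullet> w)\<^sup>2 * (1 + r * a) + (g \<bullet> v)\<^sup>2 * (W + r * C)"
    if so: "\<And>u. u \<bullet> g = 0 \<Longrightarrow> 0 \<le> u \<bullet> (A0 *v u) + (\<mu>1 + r) * (u \<bullet> (A1 *v u))" for g r
  proof -
    define u where "u = (g \<bullet> w) *\<^sub>R v - (g \<bullet> v) *\<^sub>R w"
    have "u \<bullet> g = 0" by (simp add: u_def inner_diff_left inner_diff_right inner_commute)
    hence "0 \<le> u \<bullet> (P *v u) + r * (u \<bullet> (A1 *v u))"
      using so[of u] by (simp add: Pv inner_add_right algebra_simps)
    moreover have "u \<bullet> (P *v u) = (g \<bullet> w)\<^sup>2 + (g \<bullet> v)\<^sup>2 * W"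
      by (simp add: u_def matrix_vector_mult_diff_distrib inner_diff_left inner_diff_right
          matrix_vector_mult_scaleR vv vw wv W_def power2_eq_square)
    moreover have "u \<bullet> (A1 *v u) = (g \<bullet> w)\<^sup>2 * a + (g \<bullet> v)\<^sup>2 * C"
      by (simp add: u_def matrix_vector_mult_diff_distrib inner_diff_left inner_diff_right
          matrix_vector_mult_scaleR vv1 vw1 wv1 C_def power2_eq_square)
    ultimately show ?thesis by (simp add: algebra_simps)
  qed
  have sx: "0 \<le> rx\<^sup>2 * (1 + t * a) + px\<^sup>2 * (W + t * C)"
    unfolding px_def rx_def using x by (intro so) (auto simp: nonconvex_kkt_def gx_def)
  have sy: "0 \<le> ry\<^sup>2 * (1 + s * a) + py\<^sup>2 * (W + s * C)"
    unfolding py_def ry_def using y by (intro so) (auto simp: nonconvex_kkt_def gy_def)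
  have "w = 0"
  proof (rule ccontr)
    assume "w \<noteq> 0"
    hence "W > 0" using pd by (simp add: W_def P_def pos_definite_def)
    thus False using planar_kkt_contradiction tneg sneg dp dr kp kr bd sx sy by blast
  qed
  have "\<delta> = 0"
  proof (rule ccontr)
    assume "\<delta> \<noteq> 0"
    have "\<delta> * (px + py) = 0" using bd \<open>w = 0\<close> by (simp add: rx_def ry_def)
    hence "py = - px" using \<open>\<delta> \<noteq> 0\<close> by simp
    hence "px * ((1 + t * a) + (1 + s * a)) = 0" using dp unfolding kp by algebra
    hence "px = 0" using tneg sneg by auto
    thus False using kp \<open>py = - px\<close> \<open>\<delta> \<noteq> 0\<close> by simp
  qed
  thus "x = y" using \<open>w = 0\<close> yx d by simp
qed

section \<open>Counting by the sign of \<open>\<mu> - \<mu>1\<close>\<close>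

text \<open>Only the sign of \<open>\<sigma>\<close> matters: it selects one side of \<open>\<mu>1\<close>. Taking the least eigenvector of
  \<open>\<sigma> A1\<close> instead of \<open>A1\<close> treats both sides at once. If \<open>P + r A1\<close> with \<open>\<sigma> r > 0\<close> is negative in some
  direction, then it is negative on that eigenvector, which depends on \<open>\<sigma>\<close> but not on \<open>r\<close>.\<close>

lemma at_most_one_kkt_beyond:
  fixes A0 A1 :: "real^'n^'n"
  assumes sym: "transpose A0 = A0" "transpose A1 = A1"
    and pd: "pos_definite (A0 + \<mu>1 *\<^sub>R A1)" and \<sigma>: "\<sigma> \<noteq> 0"
    and x: "nonconvex_kkt A0 b0 A1 b1 c1 (\<mu>1 + t) x" and t: "\<sigma> * t > 0"
    and y: "nonconvex_kkt A0 b0 A1 b1 c1 (\<mu>1 + s) y" and s: "\<sigma> * s > 0"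
  shows "x = y"
proof -
  define P where "P = A0 + \<mu>1 *\<^sub>R A1"
  have Pv: "P *v z = A0 *v z + \<mu>1 *\<^sub>R (A1 *v z)" for z
    by (simp add: P_def matrix_vector_mult_add_rdistrib scaleR_matrix_vector_assoc)
  have "transpose P = P" "transpose (\<sigma> *\<^sub>R A1) = \<sigma> *\<^sub>R A1"
    using sym by (simp_all add: P_def transpose_def vec_eq_iff)
  then obtain v a where v: "v \<bullet> (P *v v) = 1" "(\<sigma> *\<^sub>R A1) *v v = a *\<^sub>R (P *v v)"
    and least: "\<And>z. a * (z \<bullet> (P *v z)) \<le> z \<bullet> ((\<sigma> *\<^sub>R A1) *v z)"
    using least_generalized_eigenvector pd P_def by metis
  have "\<sigma> *\<^sub>R (A1 *v v) = a *\<^sub>R (P *v v)"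
    using v(2) by (simp add: scaleR_matrix_vector_assoc)
  hence "(1 / \<sigma>) *\<^sub>R (\<sigma> *\<^sub>R (A1 *v v)) = (1 / \<sigma>) *\<^sub>R (a *\<^sub>R (P *v v))" by simp
  hence eig: "A1 *v v = (a / \<sigma>) *\<^sub>R (P *v v)" using \<sigma> by simp
  have beyond: "1 + r * (a / \<sigma>) < 0"
    if r: "\<sigma> * r > 0" and k: "nonconvex_kkt A0 b0 A1 b1 c1 (\<mu>1 + r) u" for r u
  proof -
    obtain z where "z \<bullet> (A0 *v z) + (\<mu>1 + r) * (z \<bullet> (A1 *v z)) < 0"
      using k by (auto simp: nonconvex_kkt_def)
    hence neg: "z \<bullet> (P *v z) + r * (z \<bullet> (A1 *v z)) < 0"
      by (simp add: Pv inner_add_right algebra_simps)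
    hence "z \<noteq> 0" by auto
    hence pos: "z \<bullet> (P *v z) > 0" using pd by (simp add: P_def pos_definite_def)
    have r\<sigma>: "r / \<sigma> > 0" using r by (auto simp: zero_less_mult_iff zero_less_divide_iff)
    have "a * (z \<bullet> (P *v z)) \<le> \<sigma> * (z \<bullet> (A1 *v z))"
      using least[of z] by (simp flip: scaleR_matrix_vector_assoc)
    hence "(r / \<sigma>) * (a * (z \<bullet> (P *v z))) \<le> (r / \<sigma>) * (\<sigma> * (z \<bullet> (A1 *v z)))"
      using r\<sigma> by (intro mult_left_mono) auto
    also have "\<dots> = r * (z \<bullet> (A1 *v z))" using \<sigma> by simp
    finally have "(1 + r * (a / \<sigma>)) * (z \<bullet> (P *v z)) < 0"
      using neg by (simp add: algebra_simps)
    thus ?thesis using pos by (simp add: mult_less_0_iff)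
  qed
  show ?thesis
    using nonconvex_kkt_unique[OF sym pd _ _ x beyond[OF t x] y beyond[OF s y]] v(1) eig
    by (simp add: P_def)
qed

theorem corollary3p12:
  fixes A0 A1 :: "real^'n^'n" and b0 b1 :: "real^'n" and c1 :: real
  assumes "transpose A0 = A0" and "transpose A1 = A1"
    and "\<exists>\<mu>1. pos_definite (A0 + \<mu>1 *\<^sub>R A1)"
  shows "(pos_semidefinite A1 \<or> neg_semidefinite A1 \<longrightarrow>
            finite (gtr_lngm A0 b0 A1 b1 c1) \<and> card (gtr_lngm A0 b0 A1 b1 c1) \<le> 1)
       \<and> (indefinite A1 \<longrightarrow>
            finite (gtr_lngm A0 b0 A1 b1 c1) \<and> card (gtr_lngm A0 b0 A1 b1 c1) \<le> 2)"
proof -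
  let ?L = "gtr_lngm A0 b0 A1 b1 c1"
  obtain \<mu>1 where pd: "pos_definite (A0 + \<mu>1 *\<^sub>R A1)" using assms(3) by blast
  define K where "K \<sigma> = {x. \<exists>t. \<sigma> * t > 0 \<and> nonconvex_kkt A0 b0 A1 b1 c1 (\<mu>1 + t) x}" for \<sigma> :: real
  have K1: "finite (K \<sigma>) \<and> card (K \<sigma>) \<le> 1" if \<sigma>: "\<sigma> \<noteq> 0" for \<sigma>
  proof -
    have uniq: "x = y" if "x \<in> K \<sigma>" "y \<in> K \<sigma>" for x y
      using that at_most_one_kkt_beyond[OF assms(1,2) pd \<sigma>] by (auto simp: K_def)
    show ?thesis
    proof (cases "K \<sigma> = {}")
      case False
      then obtain x where "K \<sigma> = {x}" using uniq by blast
      thus ?thesis by simp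
    qed simp
  qed
  have form: "z \<bullet> ((A0 + \<mu>1 *\<^sub>R A1) *v z) + t * (z \<bullet> (A1 *v z))
      = z \<bullet> (A0 *v z) + (\<mu>1 + t) * (z \<bullet> (A1 *v z))" for z t
    by (simp add: matrix_vector_mult_add_rdistrib inner_add_right algebra_simps
        flip: scaleR_matrix_vector_assoc)
  have bad: "\<exists>z. t * (z \<bullet> (A1 *v z)) < 0" if k: "nonconvex_kkt A0 b0 A1 b1 c1 (\<mu>1 + t) x" for t x
  proof -
    obtain z where z: "z \<bullet> (A0 *v z) + (\<mu>1 + t) * (z \<bullet> (A1 *v z)) < 0"
      using k by (auto simp: nonconvex_kkt_def)
    hence "z \<noteq> 0" by auto
    hence "z \<bullet> ((A0 + \<mu>1 *\<^sub>R A1) *v z) > 0" using pd by (simp add: pos_definite_def)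
    thus ?thesis using z form[of z t] by (intro exI[of _ z]) linarith
  qed
  \<comment> \<open>The parameter \<open>t = 0\<close> is impossible because \<open>P\<close> has no negative direction.\<close>
  have LK: "?L \<subseteq> K 1 \<union> K (- 1)"
  proof
    fix x assume "x \<in> ?L"
    then obtain \<mu> where "nonconvex_kkt A0 b0 A1 b1 c1 \<mu> x"
      using lngm_nonconvex_kkt assms(1,2) by blast
    hence k: "nonconvex_kkt A0 b0 A1 b1 c1 (\<mu>1 + (\<mu> - \<mu>1)) x" by simp
    hence "\<mu> - \<mu>1 \<noteq> 0" using bad[OF k] by auto
    hence "1 * (\<mu> - \<mu>1) > 0 \<or> (- 1) * (\<mu> - \<mu>1) > 0" by auto
    thus "x \<in> K 1 \<union> K (- 1)" using k unfolding K_def by blast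
  qed
  have psd: "K 1 = {}" if A: "pos_semidefinite A1"
  proof -
    have "t \<le> 0" if k: "nonconvex_kkt A0 b0 A1 b1 c1 (\<mu>1 + t) x" for t x
    proof -
      obtain z where "t * (z \<bullet> (A1 *v z)) < 0" using bad[OF k] by blast
      moreover have "z \<bullet> (A1 *v z) \<ge> 0" using A by (simp add: pos_semidefinite_def)
      ultimately show ?thesis by (simp add: mult_less_0_iff)
    qed
    thus ?thesis by (force simp: K_def)
  qed
  have nsd: "K (- 1) = {}" if A: "neg_semidefinite A1"
  proof -
    have "t \<ge> 0" if k: "nonconvex_kkt A0 b0 A1 b1 c1 (\<mu>1 + t) x" for t x
    proof -
      obtain z where "t * (z \<bullet> (A1 *v z)) < 0" using bad[OF k] by blast
      moreover have "z \<bullet> (A1 *v z) \<le> 0" using A by (simp add: neg_semidefinite_def)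
      ultimately show ?thesis by (simp add: mult_less_0_iff)
    qed
    thus ?thesis by (force simp: K_def)
  qed
  have sub: "finite ?L \<and> card ?L \<le> card T" if "?L \<subseteq> T" "finite T" for T
    using that by (auto intro: finite_subset card_mono)
  have one: "finite ?L \<and> card ?L \<le> 1" if "pos_semidefinite A1 \<or> neg_semidefinite A1"
  proof -
    have "?L \<subseteq> K 1 \<or> ?L \<subseteq> K (- 1)" using that LK psd nsd by auto
    thus ?thesis using sub[of "K 1"] sub[of "K (- 1)"] K1[of 1] K1[of "- 1"] by fastforce
  qed
  have two: "finite ?L \<and> card ?L \<le> 2"
    using sub[OF LK] K1[of 1] K1[of "- 1"] card_Un_le[of "K 1" "K (- 1)"] by fastforce
  show ?thesis using one two by blast
qed

end
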